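(* Let $\Omega$ be an at most countable set, $\mathcal{F}=2^\Omega$, and for each $t\in\mathbb{N}_0$ let $\Omega=\Omega_t^-\sqcup\Omega_t^+$ with $\Omega_0^+\ne\emptyset$, $\Omega_t^+\subset\Omega_{t+1}^+$ and $\Omega_t^-\supset\Omega_{t+1}^-$. Let $P$ be a (countably additive) probability measure on $(\Omega,\mathcal{F})$ and let $P_\infty^{ex}$ be the associated limiting extended probability on $\mathcal{F}$. If $\Omega_t^+\uparrow\Omega$ (that is, $\bigcup_{t\in\mathbb{N}_0}\Omega_t^+=\Omega$), then $P_\infty^{ex}(\Omega)=1$.
   Context: $\mathbb{N}_0=\mathbb{N}\cup\{0\}$; $\sqcup$ denotes disjoint union. The set function $P_\infty^{ex}:\mathcal{F}\to\mathbb{R}$ is the countably additive set function determined by $$P^{ex}_\infty\Big(A\cap\bigcup_{t}\Omega_t^+\Big)=P\Big(A\cap\bigcup_{t}\Omega_t^+\Big),\qquad P^{ex}_\infty\Big(A\cap\bigcap_{t}\Omega_t^-\Big)=-P\Big(A\cap\bigcap_{t}\Omega_t^-\Big)$$ for all $A\in\mathcal{F}$. *)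

theory Defs
  imports "HOL-Probability.Probability"
begin

text \<open>The sample space is \<open>space M\<close>, the \<open>\<sigma>\<close>-algebra is \<open>sets M\<close> and \<open>P\<close> is \<open>measure M\<close>;
  \<open>Wm t\<close> and \<open>Wp t\<close> stand for the negative and positive parts of the sample space at time \<open>t\<close>.
  The library's predicate \<open>countably_additive\<close> only covers functions with values in \<open>ennreal\<close>;
  here is the same notion for real-valued set functions.\<close>

definition real_countably_additive :: "'a set set \<Rightarrow> ('a set \<Rightarrow> real) \<Rightarrow> bool" where
  "real_countably_additive F Q \<longleftrightarrow>
     (\<forall>A::nat \<Rightarrow> 'a set. range A \<subseteq> F \<longrightarrow> disjoint_family A \<longrightarrow> (\<Union>i. A i) \<in> F \<longrightarrow>
        (\<lambda>i. Q (A i)) sums Q (\<Union>i. A i))"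

definition is_limiting_extended_probability ::
    "'a measure \<Rightarrow> (nat \<Rightarrow> 'a set) \<Rightarrow> (nat \<Rightarrow> 'a set) \<Rightarrow> ('a set \<Rightarrow> real) \<Rightarrow> bool" where
  "is_limiting_extended_probability M Wm Wp Q \<longleftrightarrow>
     real_countably_additive (sets M) Q \<and>
     (\<forall>A\<in>sets M. Q (A \<inter> (\<Union>t. Wp t)) = measure M (A \<inter> (\<Union>t. Wp t))) \<and>
     (\<forall>A\<in>sets M. Q (A \<inter> (\<Inter>t. Wm t)) = - measure M (A \<inter> (\<Inter>t. Wm t)))"

text \<open>A function on \<open>sets M\<close> is an element of \<open>extensional (sets M)\<close>: it carries no information
  outside \<open>sets M\<close>. Without this the description would not be unique.\<close>

definition limiting_extended_probability ::
    "'a measure \<Rightarrow> (nat \<Rightarrow> 'a set) \<Rightarrow> (nat \<Rightarrow> 'a set) \<Rightarrow> 'a set \<Rightarrow> real" where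
  "limiting_extended_probability M Wm Wp =
     (THE Q. Q \<in> extensional (sets M) \<and> is_limiting_extended_probability M Wm Wp Q)"

lemma real_countably_additive_empty:
  assumes "real_countably_additive F Q" "{} \<in> F"
  shows "Q {} = 0"
proof -
  have "(\<lambda>i::nat. Q {}) sums Q (\<Union>i::nat. {})"
    using assms unfolding real_countably_additive_def
    by (elim allE[of _ "\<lambda>_::nat. {}"]) (simp add: disjoint_family_on_def)
  then have "summable (\<lambda>i::nat. Q {})"
    by (rule sums_summable)
  then show ?thesis
    by (simp add: summable_const_iff)
qed

lemma real_countably_additive_Un:
  assumes Q: "real_countably_additive F Q" and F: "{} \<in> F" "A \<in> F" "B \<in> F" "A \<union> B \<in> F"
    and disj: "A \<inter> B = {}"
  shows "Q (A \<union> B) = Q A + Q B"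
proof -
  have un: "(\<Union>i. binaryset A B i) = A \<union> B"
    by (simp add: UN_binaryset_eq)
  have "(\<lambda>i. Q (binaryset A B i)) sums Q (A \<union> B)"
  proof -
    have "range (binaryset A B) \<subseteq> F"
      using F by (simp add: range_binaryset_eq)
    moreover have "disjoint_family (binaryset A B)"
      using disj by (auto simp: disjoint_family_on_def binaryset_def)
    ultimately have "(\<lambda>i. Q (binaryset A B i)) sums Q (\<Union>i. binaryset A B i)"
      using Q F(4) unfolding real_countably_additive_def un[symmetric] by blast
    then show ?thesis
      by (simp only: un)
  qed
  moreover have "(\<lambda>i. Q (binaryset A B i)) sums (Q A + Q B)"
    by (rule binaryset_sums) (rule real_countably_additive_empty[OF Q F(1)])
  ultimately show ?thesis
    by (rule sums_unique2)
qed

text \<open>Existence and uniqueness, so that the definite description above is well-defined.\<close>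

lemma limiting_extended_probability_ex1:
  assumes "prob_space M" and sets: "sets M = Pow (space M)"
    and cover: "\<And>t. Wm t \<union> Wp t = space M" and disj: "\<And>t. Wm t \<inter> Wp t = {}"
  shows "\<exists>!Q. Q \<in> extensional (sets M) \<and> is_limiting_extended_probability M Wm Wp Q"
proof -
  interpret prob_space M by fact
  let ?U = "\<Union>t. Wp t" and ?I = "\<Inter>t. Wm t"
  have UI: "?U \<inter> ?I = {}" using disj by blast
  have split: "A = (A \<inter> ?U) \<union> (A \<inter> ?I)" if "A \<in> sets M" for A
    using that cover unfolding sets by blast
  have int: "A \<inter> B \<in> sets M" if "A \<in> sets M" for A B
    using that unfolding sets by blast
  let ?Q = "restrict (\<lambda>A. measure M (A \<inter> ?U) - measure M (A \<inter> ?I)) (sets M)"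
  show ?thesis
  proof (rule ex1I[of _ ?Q])
    have add: "(\<lambda>i. measure M (A i \<inter> B)) sums measure M ((\<Union>i. A i) \<inter> B)"
      if "range A \<subseteq> sets M" "disjoint_family A" for A :: "nat \<Rightarrow> 'a set" and B
    proof -
      have r: "range (\<lambda>i. A i \<inter> B) \<subseteq> sets M"
        using that(1) int by blast
      have d: "disjoint_family (\<lambda>i. A i \<inter> B)"
        using that(2) unfolding disjoint_family_on_def by blast
      have "(\<Union>i. A i \<inter> B) = (\<Union>i. A i) \<inter> B" by blast
      then show ?thesis
        using finite_measure_UNION[OF r d] by (simp only:)
    qed
    have "real_countably_additive (sets M) ?Q"
      unfolding real_countably_additive_def
    proof (intro allI impI)
      fix A :: "nat \<Rightarrow> 'a set"
      assume A: "range A \<subseteq> sets M" "disjoint_family A" "(\<Union>i. A i) \<in> sets M"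
      then have "A i \<in> sets M" for i by blast
      show "(\<lambda>i. ?Q (A i)) sums ?Q (\<Union>i. A i)"
        using sums_diff[OF add[OF A(1,2), of ?U] add[OF A(1,2), of ?I]] A(3)
        by (simp only: restrict_apply' \<open>\<And>i. A i \<in> sets M\<close>)
    qed
    moreover have "?Q (A \<inter> ?U) = measure M (A \<inter> ?U)" if "A \<in> sets M" for A
    proof -
      have "A \<inter> ?U \<inter> ?I = {}" using UI by blast
      moreover have "A \<inter> ?U \<inter> ?U = A \<inter> ?U" by blast
      ultimately show ?thesis
        using int[OF that, of ?U] by (simp only: restrict_apply' measure_empty diff_0_right diff_0)
    qed
    moreover have "?Q (A \<inter> ?I) = - measure M (A \<inter> ?I)" if "A \<in> sets M" for A
    proof -
      have "A \<inter> ?I \<inter> ?U = {}" using UI by blast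
      moreover have "A \<inter> ?I \<inter> ?I = A \<inter> ?I" by blast
      ultimately show ?thesis
        using int[OF that, of ?I] by (simp only: restrict_apply' measure_empty diff_0_right diff_0)
    qed
    ultimately show "?Q \<in> extensional (sets M) \<and> is_limiting_extended_probability M Wm Wp ?Q"
      unfolding is_limiting_extended_probability_def by blast
  next
    fix Q
    assume Q: "Q \<in> extensional (sets M) \<and> is_limiting_extended_probability M Wm Wp Q"
    show "Q = ?Q"
    proof (rule extensionalityI[of _ "sets M"])
      fix A assume A: "A \<in> sets M"
      have "Q ((A \<inter> ?U) \<union> (A \<inter> ?I)) = Q (A \<inter> ?U) + Q (A \<inter> ?I)"
      proof (rule real_countably_additive_Un)
        show "real_countably_additive (sets M) Q"
          using Q unfolding is_limiting_extended_probability_def by blast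
        show "{} \<in> sets M" "A \<inter> ?U \<in> sets M" "A \<inter> ?I \<in> sets M"
          using int[OF A] by blast+
        show "A \<inter> ?U \<union> A \<inter> ?I \<in> sets M"
          using A unfolding split[OF A, symmetric] .
        show "A \<inter> ?U \<inter> (A \<inter> ?I) = {}"
          using UI by blast
      qed
      then have "Q A = Q (A \<inter> ?U) + Q (A \<inter> ?I)"
        unfolding split[OF A, symmetric] .
      also have "\<dots> = ?Q A"
      proof -
        have "Q (A \<inter> ?U) = measure M (A \<inter> ?U)" "Q (A \<inter> ?I) = - measure M (A \<inter> ?I)"
          using Q A unfolding is_limiting_extended_probability_def by blast+
        then show ?thesis
          using A by (simp only: restrict_apply' add_uminus_conv_diff)
      qed
      finally show "Q A = ?Q A" .
    qed (use Q in auto)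
  qed
qed

end

theory Submission
  imports Defs
begin

text \<open>On subsets of the union of the \<open>Wp t\<close> the limiting extended probability
  agrees with P. When that union is the whole space, its value there is the total mass 1. The
  remaining point is that the definite description denotes such a function, which
  \<open>limiting_extended_probability_ex1\<close> guarantees.\<close>

theorem proposition16:
  fixes M :: "'a measure" and Wm Wp :: "nat \<Rightarrow> 'a set"
  assumes "prob_space M"
    and "countable (space M)"
    and "sets M = Pow (space M)"
    and "\<And>t. space M = Wm t \<union> Wp t"
    and "\<And>t. Wm t \<inter> Wp t = {}"
    and "Wp 0 \<noteq> {}"
    and "\<And>t. Wp t \<subseteq> Wp (Suc t)"
    and "\<And>t. Wm (Suc t) \<subseteq> Wm t"
    and "(\<Union>t. Wp t) = space M"
  shows "limiting_extended_probability M Wm Wp (space M) = 1"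
proof -
  interpret prob_space M by fact
  \<comment> \<open>Nothing can be read off the \<open>THE\<close> term before existence and
    uniqueness are known.\<close>
  have "\<exists>!Q. Q \<in> extensional (sets M) \<and> is_limiting_extended_probability M Wm Wp Q"
    by (rule limiting_extended_probability_ex1[OF assms(1,3) assms(4)[symmetric] assms(5)])
  then have "is_limiting_extended_probability M Wm Wp (limiting_extended_probability M Wm Wp)"
    unfolding limiting_extended_probability_def by (rule theI'[THEN conjunct2])
  \<comment> \<open>This is the positive clause at \<open>A = space M\<close>, with the intersection
    kept so that it matches; exhaustion collapses it afterwards.\<close>
  then have "limiting_extended_probability M Wm Wp (space M \<inter> (\<Union>t. Wp t))
      = measure M (space M \<inter> (\<Union>t. Wp t))"
    unfolding is_limiting_extended_probability_def by blast
  then show ?thesis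
    by (simp add: assms(9) prob_space)
qed

end
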